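(* Fix $c>1$ and let $d=d(n)$ satisfy $d=\omega(\log n)$. Consider any (randomized) cell-probe data structure that stores an $n$-point dataset $P\subset\{-1,1\}^d$ in $m$ memory cells of $w=n^{o(1)}$ bits each, answers every query by reading a single cell, and solves $(c,r)$-ANN on the Hamming random instance with probability at least $2/3$. Then $m\ge n^{\left(\frac{c}{c-1}\right)^2-o(1)}$.
   Context: Hamming random instance: the dataset $P$ consists of $n$ independent uniformly random points of $\{-1,1\}^d$; a query $q$ is generated by choosing a uniformly random $p\in P$ and flipping each coordinate of $p$ independently with probability $\frac{1}{2c}$. With high probability $\|q-p\|_1\le (1+o(1))\frac{d}{2c}$ while every other data point is at Hamming distance at least $(1-o(1))\frac d2$ from $q$; the goal is to recover $p$ from $q$. $(c,r)$-ANN: given $q$ with some $p\in P$ at Hamming distance at most $r$, return some $p'\in P$ at distance at most $cr$. In the cell-probe model, only the number of memory cells read by the query algorithm is counted; the preprocessing produces the cell contents from $P$. Asymptotics are as $n\to\infty$ with $c$ fixed. *)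

theory Defs
  imports "HOL-Probability.Probability" "HOL-Probability.Product_PMF"
    "HOL-Library.Landau_Symbols"
begin

(* A point of {-1,1}^d is a function that vanishes outside {..<d}, so that the finite
   product constructions PiE_dflt and Pi_pmf (with default value 0) apply. *)
type_synonym point = "nat \<Rightarrow> int"

definition hypercube :: "nat \<Rightarrow> point set" where
  "hypercube d = PiE_dflt {..<d} 0 (\<lambda>_. {-1, 1})"

definition random_dataset :: "nat \<Rightarrow> nat \<Rightarrow> (nat \<Rightarrow> point) pmf" where
  "random_dataset n d = Pi_pmf {..<n} (\<lambda>_. 0) (\<lambda>_. pmf_of_set (hypercube d))"

definition flip_coordinates :: "real \<Rightarrow> nat \<Rightarrow> point \<Rightarrow> point pmf" where
  "flip_coordinates \<delta> d p =
     Pi_pmf {..<d} 0 (\<lambda>i. map_pmf (\<lambda>flip. if flip then - p i else p i) (bernoulli_pmf \<delta>))"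

(* Joint distribution of (dataset, planted data point, query). *)
definition hamming_random_instance ::
    "real \<Rightarrow> nat \<Rightarrow> nat \<Rightarrow> ((nat \<Rightarrow> point) \<times> point \<times> point) pmf" where
  "hamming_random_instance c n d =
     do {
       P \<leftarrow> random_dataset n d;
       i \<leftarrow> pmf_of_set {..<n};
       q \<leftarrow> flip_coordinates (1 / (2 * c)) d (P i);
       return_pmf (P, P i, q)
     }"

(* A deterministic structure whose query algorithm reads one cell: the probed address depends
   only on the query, and the answer only on the query and the contents of that cell.
   The preprocessing, the choice of address and the answer are otherwise arbitrary. *)
datatype single_probe =
  Single_Probe
    (cells: "(nat \<Rightarrow> point) \<Rightarrow> nat \<Rightarrow> bool list")
    (address: "point \<Rightarrow> nat")
    (answer: "point \<Rightarrow> bool list \<Rightarrow> point")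

definition run_query :: "single_probe \<Rightarrow> (nat \<Rightarrow> point) \<Rightarrow> point \<Rightarrow> point" where
  "run_query S P q = answer S q (cells S P (address S q))"

definition uses_cells :: "nat \<Rightarrow> nat \<Rightarrow> nat \<Rightarrow> nat \<Rightarrow> single_probe \<Rightarrow> bool" where
  "uses_cells n d m w S \<longleftrightarrow>
     (\<forall>P \<in> PiE_dflt {..<n} (\<lambda>_. 0) (\<lambda>_. hypercube d). \<forall>j<m. length (cells S P j) = w) \<and>
     (\<forall>q \<in> hypercube d. address S q < m)"

(* A randomized structure is a distribution over deterministic ones, so preprocessing and query
   algorithm may share random coins. As only finitely many deterministic structures differ on
   the relevant inputs, a pmf loses no generality over an arbitrary probability space. *)
definition randomized_single_probe ::
    "nat \<Rightarrow> nat \<Rightarrow> nat \<Rightarrow> nat \<Rightarrow> single_probe pmf \<Rightarrow> bool" where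
  "randomized_single_probe n d m w D \<longleftrightarrow> (\<forall>S \<in> set_pmf D. uses_cells n d m w S)"

(* On the random instance the near neighbour is the planted point p, at distance about d/(2c),
   while all other points are at distance about d/2: solving the instance means returning p.
   The probability is over the coins of the structure, the dataset and the query. *)
definition success_probability :: "real \<Rightarrow> nat \<Rightarrow> nat \<Rightarrow> single_probe pmf \<Rightarrow> real" where
  "success_probability c n d D =
     measure_pmf.prob (pair_pmf D (hamming_random_instance c n d))
       {(S, P, p, q). run_query S P q = p}"

end

(* For a fixed cell j and fixed contents x, the data points recovered from that cell number
   in expectation h(p_1) + ... + h(p_n), where h(p) is the probability that the noisy copy of p
   probes j and is answered by p. As d = \<omega>(log n), the mean of h is negligible, so if h were
   bounded by \<tau>, a Chernoff bound over the 2^w possible contents would give at most about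
   \<tau> w recovered points whatever the preprocessing does. The points at which the probability of
   probing j exceeds \<tau> are controlled by hypercontractivity of the noise operator with correlation
   \<rho> = 1 - 1/c, from L^r to L^s with r - 1 = \<rho>^2 (s - 1). Taking \<tau> proportional to
   (\<mu>_j + 1/m) n / w, with \<mu>_j the measure of the queries probing j, the two bounds add up to a
   success probability of at most 1/10 + m^(s - s/r) (20 (w + 1) / n)^(s - 1); letting s tend to 1
   yields m >= n^(1/\<rho>^2 - o(1)). *)

theory Submission
  imports Defs "HOL-Real_Asymp.Real_Asymp"
begin

section \<open>Hypercontractivity on the discrete cube\<close>

lemma gbinomial_even_Suc:
  fixes a :: real
  shows "a gchoose (2 * Suc k) =
    (a gchoose (2 * k)) * ((2 * k - a) * (2 * k + 1 - a)) / ((2 * k + 1) * (2 * k + 2))"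
proof -
  have step: "a gchoose (Suc j) = (a gchoose j) * (a - j) / (j + 1)" for j
    using gbinomial_mult_1[of a j] by (simp add: field_simps)
  have "a gchoose (2 * Suc k) = (a gchoose (2 * k)) * (a - 2 * k) / (2 * k + 1) * (a - (2 * k + 1)) / (2 * k + 2)"
    using step[of "Suc (2 * k)"] step[of "2 * k"] by (simp add: add_ac)
  \<comment> \<open>Both factors change sign, so for a < 2 and k >= 1 the coefficient is visibly
    multiplied by a positive number.\<close>
  also have "\<dots> = (a gchoose (2 * k)) * ((2 * k - a) * (2 * k + 1 - a)) / ((2 * k + 1) * (2 * k + 2))"
    by (simp add: field_simps)
  finally show ?thesis
    by (simp only: of_nat_mult of_nat_add of_nat_numeral of_nat_1)
qed

text \<open>Induction on \<open>k\<close>. At \<open>k = 1\<close> both sides agree, by the relation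
  between \<open>r\<close>, \<open>s\<close> and \<open>\<rho>\<close>. Each further step multiplies
  the left by \<open>\<rho>\<^sup>2\<close> times a product that decreases in the exponent, and the
  right by the same product at the smaller exponent \<open>r\<close>. The bound \<open>s < 2\<close>
  keeps all factors nonnegative.\<close>

lemma gbinomial_even_compare:
  fixes r s \<rho> :: real
  assumes "1 < r" "r \<le> s" "s < 2" "\<rho>\<^sup>2 * (s - 1) = r - 1" "0 \<le> \<rho>" "\<rho> \<le> 1" "1 \<le> k"
  shows "0 \<le> s gchoose (2 * k) \<and> r * (s gchoose (2 * k)) * \<rho> ^ (2 * k) \<le> s * (r gchoose (2 * k))"
  using \<open>1 \<le> k\<close>
proof (induction k rule: dec_induct)
  case base
  have two: "x gchoose (2 * 1) = x * (x - 1) / 2" for x :: real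
    using gbinomial_even_Suc[of x 0] by (simp add: algebra_simps)
  have "r * (s * (s - 1) / 2) * \<rho>\<^sup>2 = r * s / 2 * (\<rho>\<^sup>2 * (s - 1))"
    by simp
  then show ?case
    unfolding two assms(4) using assms(1-3) by simp
next
  case (step k)
  let ?S = "s gchoose (2 * k)" and ?R = "r gchoose (2 * k)"
  let ?x = "(2 * real k - s) * (2 * real k + 1 - s)" and ?y = "(2 * real k - r) * (2 * real k + 1 - r)"
  have k: "real k \<ge> 1" using step by simp
  have x0: "0 \<le> ?x" using assms k by (intro mult_nonneg_nonneg) auto
  have xy: "?x \<le> ?y" using assms k by (intro mult_mono) auto
  have \<rho>2: "\<rho>\<^sup>2 \<le> 1" using assms by (simp add: power_le_one)
  define q where "q = (2 * real k + 1) * (2 * real k + 2)"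
  have q: "q > 0" unfolding q_def by (intro mult_pos_pos) auto
  have S0: "0 \<le> r * ?S * \<rho> ^ (2 * k)" using step.IH assms by simp
  have "r * ?S * \<rho> ^ (2 * k) * (\<rho>\<^sup>2 * ?x) \<le> s * ?R * (1 * ?y)"
  proof (rule mult_mono)
    show "r * ?S * \<rho> ^ (2 * k) \<le> s * ?R" using step.IH by simp
    then show "0 \<le> s * ?R" using S0 by linarith
    show "\<rho>\<^sup>2 * ?x \<le> 1 * ?y" by (rule mult_mono[OF \<rho>2 xy]) (use x0 in auto)
    show "0 \<le> \<rho>\<^sup>2 * ?x" by (rule mult_nonneg_nonneg[OF _ x0]) simp
  qed
  then have "r * ?S * \<rho> ^ (2 * k) * (\<rho>\<^sup>2 * ?x) / q \<le> s * ?R * (1 * ?y) / q"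
    using q by (intro divide_right_mono) auto
  moreover have "r * (?S * ?x / q) * \<rho> ^ (2 * Suc k) = r * ?S * \<rho> ^ (2 * k) * (\<rho>\<^sup>2 * ?x) / q"
    by (simp add: power2_eq_square mult_ac)
  moreover have "s * (?R * ?y / q) = s * ?R * (1 * ?y) / q"
    by simp
  moreover have "0 \<le> ?S * ?x / q"
    by (intro divide_nonneg_nonneg mult_nonneg_nonneg x0) (use step.IH q in auto)
  ultimately show ?case
    unfolding gbinomial_even_Suc q_def[symmetric] by (simp only:)
qed

text \<open>A concave power lies below its tangent at 1; this is Young's inequality against the
  constant 1.\<close>

lemma powr_le_linear:
  fixes x a :: real
  assumes "0 < x" "0 < a" "a \<le> 1"
  shows "x powr a \<le> 1 + a * (x - 1)"
  using Youngs_inequality_0[of a "1 - a" x 1] assms by (simp add: algebra_simps)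

text \<open>The binomial series of both sides are compared coefficientwise; only even powers survive.\<close>

lemma two_point_normalized:
  fixes r s \<rho> b :: real
  assumes rs: "1 < r" "r \<le> s" "s < 2" "\<rho>\<^sup>2 * (s - 1) = r - 1" "0 \<le> \<rho>" "\<rho> \<le> 1" and b: "\<bar>b\<bar> < 1"
  shows "((1 + \<rho> * b) powr s + (1 - \<rho> * b) powr s) / 2 \<le>
    (((1 + b) powr r + (1 - b) powr r) / 2) powr (s / r)"
proof -
  have even_sums: "(\<lambda>n. (a gchoose n) * (z ^ n + (- z) ^ n) / 2) sums (((1 + z) powr a + (1 - z) powr a) / 2)"
    if "\<bar>z\<bar> < 1" for a z :: real
    using sums_divide[OF sums_add[OF gen_binomial_real[of z a] gen_binomial_real[of "-z" a]], of 2] that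
    by (simp add: distrib_left)
  define \<phi> where "\<phi> a z = ((1 + z) powr a + (1 - z) powr a) / 2" for a z :: real
  \<comment> \<open>The constant term 1 is split off because the comparison wanted is between the
    deviations from 1, scaled by \<open>r\<close> and \<open>s\<close>.\<close>
  have tail: "(\<lambda>n. (a gchoose Suc n) * (z ^ Suc n + (- z) ^ Suc n) / 2) sums (\<phi> a z - 1)"
    if "\<bar>z\<bar> < 1" for a z :: real
    using even_sums[OF that, of a] unfolding \<phi>_def by (subst sums_Suc_iff) simp
  have \<rho>b: "\<bar>\<rho> * b\<bar> < 1"
    using mult_left_le_one_le[of "\<bar>b\<bar>" \<rho>] rs b by (simp add: abs_mult)
  have terms: "r * ((s gchoose n) * ((\<rho> * b) ^ n + (- (\<rho> * b)) ^ n) / 2) \<le> s * ((r gchoose n) * (b ^ n + (- b) ^ n) / 2)"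
    if "n > 0" for n
  proof (cases "even n")
    case True
    then obtain k where k: "n = 2 * k" by auto
    then have "r * (s gchoose n) * \<rho> ^ n * b ^ n \<le> s * (r gchoose n) * b ^ n"
      using gbinomial_even_compare[OF rs, of k] that by (intro mult_right_mono) auto
    then show ?thesis using k by (simp add: power_mult_distrib mult_ac)
  qed auto
  have "r * (\<phi> s (\<rho> * b) - 1) \<le> s * (\<phi> r b - 1)"
    by (rule sums_le[OF _ sums_mult[OF tail[OF \<rho>b]] sums_mult[OF tail[OF b]]]) (rule terms, simp)
  then have "r * (\<phi> s (\<rho> * b) - 1) / s \<le> \<phi> r b - 1"
    using rs by (simp add: pos_divide_le_eq mult.commute)
  then have lin: "1 + r / s * (\<phi> s (\<rho> * b) - 1) \<le> \<phi> r b"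
    by simp
  have pos: "0 < \<phi> s (\<rho> * b)"
    using \<rho>b unfolding \<phi>_def by (intro divide_pos_pos add_pos_pos) (auto simp: powr_gt_zero)
  \<comment> \<open>Since \<open>r / s \<le> 1\<close>, the power lies below its tangent at 1, so
    the linear comparison of the two series is enough.\<close>
  have "\<phi> s (\<rho> * b) powr (r / s) \<le> \<phi> r b"
    using powr_le_linear[OF pos, of "r / s"] lin rs by simp
  then have "(\<phi> s (\<rho> * b) powr (r / s)) powr (s / r) \<le> \<phi> r b powr (s / r)"
    using rs by (intro powr_mono2) auto
  moreover have "(\<phi> s (\<rho> * b) powr (r / s)) powr (s / r) = \<phi> s (\<rho> * b)"
    using rs pos by (simp add: powr_powr)
  ultimately show ?thesis unfolding \<phi>_def by simp
qed

text \<open>Both sides are homogeneous of degree \<open>s\<close>, so the mean of \<open>x\<close>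
  and \<open>y\<close> can be scaled to 1. Strict positivity makes the relative deviation
  \<open>b\<close> smaller than 1 in absolute value, as the binomial series requires.\<close>

lemma two_point_pos:
  fixes r s \<rho> x y :: real
  assumes rs: "1 < r" "r \<le> s" "s < 2" "\<rho>\<^sup>2 * (s - 1) = r - 1" "0 \<le> \<rho>" "\<rho> \<le> 1"
    and xy: "0 < x" "0 < y"
  shows "(((1 + \<rho>) / 2 * x + (1 - \<rho>) / 2 * y) powr s + ((1 - \<rho>) / 2 * x + (1 + \<rho>) / 2 * y) powr s) / 2
    \<le> ((x powr r + y powr r) / 2) powr (s / r)"
proof -
  define a where "a = (x + y) / 2"
  define b where "b = (x - y) / (2 * a)"
  have a: "a > 0" using xy by (simp add: a_def)
  have b: "\<bar>b\<bar> < 1" using xy a by (simp add: b_def abs_less_iff a_def)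
  have x: "x = a * (1 + b)" and y: "y = a * (1 - b)"
  proof -
    have "a * b = (x - y) / 2" using a by (simp add: b_def)
    moreover have "2 * a = x + y" by (simp add: a_def)
    ultimately have "a + a * b = x" "a - a * b = y" by simp_all
    then show "x = a * (1 + b)" "y = a * (1 - b)" by (simp_all add: distrib_left right_diff_distrib)
  qed
  have \<rho>b: "\<bar>\<rho> * b\<bar> < 1"
    using mult_left_le_one_le[of "\<bar>b\<bar>" \<rho>] rs b by (simp add: abs_mult)
  have pm: "(a * u) powr v = a powr v * u powr v" if "0 \<le> u" for u v
    using a that by (simp add: powr_mult)
  have e: "(1 + \<rho>) / 2 * x + (1 - \<rho>) / 2 * y = a * (1 + \<rho> * b)"
    "(1 - \<rho>) / 2 * x + (1 + \<rho>) / 2 * y = a * (1 - \<rho> * b)"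
    by (simp_all add: x y algebra_simps add_divide_distrib diff_divide_distrib)
  have "(((1 + \<rho>) / 2 * x + (1 - \<rho>) / 2 * y) powr s + ((1 - \<rho>) / 2 * x + (1 + \<rho>) / 2 * y) powr s) / 2
    = a powr s * (((1 + \<rho> * b) powr s + (1 - \<rho> * b) powr s) / 2)"
    unfolding e using \<rho>b by (simp add: pm flip: distrib_left)
  also have "\<dots> \<le> a powr s * (((1 + b) powr r + (1 - b) powr r) / 2) powr (s / r)"
    by (rule mult_left_mono[OF two_point_normalized[OF rs b]]) simp
  also have "\<dots> = (a powr r * (((1 + b) powr r + (1 - b) powr r) / 2)) powr (s / r)"
    using powr_mult[of "a powr r" "((1 + b) powr r + (1 - b) powr r) / 2" "s / r"] rs
    by (simp add: powr_powr)
  also have "a powr r * (((1 + b) powr r + (1 - b) powr r) / 2) = (x powr r + y powr r) / 2"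
    using b by (simp add: pm x y flip: distrib_left)
  finally show ?thesis .
qed

text \<open>Zero values are reached by continuity: both arguments are shifted by 1/(n+1) and the
  positive case passes to the limit.\<close>

lemma two_point_hypercontractive:
  fixes r s \<rho> x y :: real
  assumes rs: "1 < r" "r \<le> s" "s < 2" "\<rho>\<^sup>2 * (s - 1) = r - 1" "0 \<le> \<rho>" "\<rho> \<le> 1"
    and xy: "0 \<le> x" "0 \<le> y"
  shows "(((1 + \<rho>) / 2 * x + (1 - \<rho>) / 2 * y) powr s + ((1 - \<rho>) / 2 * x + (1 + \<rho>) / 2 * y) powr s) / 2
    \<le> ((x powr r + y powr r) / 2) powr (s / r)"
proof -
  define L R where "L x y = (((1 + \<rho>) / 2 * x + (1 - \<rho>) / 2 * y) powr s + ((1 - \<rho>) / 2 * x + (1 + \<rho>) / 2 * y) powr s) / 2"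
    and "R x y = ((x powr r + y powr r) / 2) powr (s / r)" for x y
  have ex: "(\<lambda>n. x + 1 / Suc n) \<longlonglongrightarrow> x" and ey: "(\<lambda>n. y + 1 / Suc n) \<longlonglongrightarrow> y"
    using tendsto_add[OF tendsto_const[of x] LIMSEQ_Suc[OF lim_1_over_n]]
      tendsto_add[OF tendsto_const[of y] LIMSEQ_Suc[OF lim_1_over_n]] by simp_all
  have powr_lim: "(\<lambda>n. f n powr a) \<longlonglongrightarrow> l powr a" if "f \<longlonglongrightarrow> l" "a > 0" "\<And>n. f n \<ge> 0" for f :: "nat \<Rightarrow> real" and a l
    using that by (intro tendsto_powr') auto
  have lin: "(\<lambda>n. u * (x + 1 / Suc n) + v * (y + 1 / Suc n)) \<longlonglongrightarrow> u * x + v * y" for u v :: real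
    by (rule tendsto_add[OF tendsto_mult_left[OF ex] tendsto_mult_left[OF ey]])
  have "(\<lambda>n. L (x + 1 / Suc n) (y + 1 / Suc n)) \<longlonglongrightarrow> L x y"
    unfolding L_def
    by (rule tendsto_divide[OF tendsto_add[OF powr_lim[OF lin] powr_lim[OF lin]] tendsto_const]) (use rs xy in simp_all)
  moreover have "(\<lambda>n. R (x + 1 / Suc n) (y + 1 / Suc n)) \<longlonglongrightarrow> R x y"
    unfolding R_def
    by (rule powr_lim[OF tendsto_divide[OF tendsto_add[OF powr_lim[OF ex] powr_lim[OF ey]] tendsto_const]]) (use rs xy in simp_all)
  moreover have "L (x + 1 / Suc n) (y + 1 / Suc n) \<le> R (x + 1 / Suc n) (y + 1 / Suc n)" for n
    unfolding L_def R_def using xy by (intro two_point_pos rs add_nonneg_pos) simp_all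
  ultimately have "L x y \<le> R x y"
    by (meson LIMSEQ_le)
  then show ?thesis unfolding L_def R_def .
qed

text \<open>After division by the two norms this is Young's inequality, averaged over the two
  points; a vanishing norm is treated apart. It turns a norm bound on the noise operator into a
  bilinear one.\<close>

lemma Holder_two_points:
  fixes a b u v s t :: real
  assumes nn: "0 \<le> a" "0 \<le> b" "0 \<le> u" "0 \<le> v" and st: "1 < s" "1 < t" "1 / s + 1 / t = 1"
  shows "(a * u + b * v) / 2 \<le> ((a powr t + b powr t) / 2) powr (1 / t) * ((u powr s + v powr s) / 2) powr (1 / s)"
proof -
  define A B where "A = (a powr t + b powr t) / 2" and "B = (u powr s + v powr s) / 2"
  show ?thesis
  proof (cases "A = 0 \<or> B = 0")
    case True
    then have "a = 0 \<and> b = 0 \<or> u = 0 \<and> v = 0"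
      by (auto simp: A_def B_def add_nonneg_eq_0_iff)
    then show ?thesis by auto
  next
    case False
    then have AB: "A > 0" "B > 0" by (auto simp: A_def B_def less_le)
    define \<alpha> \<beta> where "\<alpha> = A powr (1 / t)" and "\<beta> = B powr (1 / s)"
    have \<alpha>\<beta>: "\<alpha> > 0" "\<beta> > 0" "\<alpha> powr t = A" "\<beta> powr s = B"
      using AB st by (auto simp: \<alpha>_def \<beta>_def powr_powr)
    have young: "x * y / (\<alpha> * \<beta>) \<le> x powr t / A / t + y powr s / B / s" if "0 \<le> x" "0 \<le> y" for x y
      using Youngs_inequality[of t s "x / \<alpha>" "y / \<beta>"] that st \<alpha>\<beta> by (simp add: powr_divide add.commute)
    have "(a * u + b * v) / 2 / (\<alpha> * \<beta>) = (a * u / (\<alpha> * \<beta>) + b * v / (\<alpha> * \<beta>)) / 2"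
      by (simp add: add_divide_distrib)
    also have "\<dots> \<le> ((a powr t / A / t + u powr s / B / s) + (b powr t / A / t + v powr s / B / s)) / 2"
      by (intro divide_right_mono add_mono young nn) simp
    also have "\<dots> = (a powr t + b powr t) / 2 / A / t + (u powr s + v powr s) / 2 / B / s"
      by (simp add: add_divide_distrib)
    also have "\<dots> = 1"
      unfolding A_def[symmetric] B_def[symmetric] using AB st by simp
    finally show ?thesis
      unfolding A_def[symmetric] B_def[symmetric] \<alpha>_def[symmetric] \<beta>_def[symmetric]
      using \<alpha>\<beta> by (simp add: pos_divide_le_eq)
  qed
qed

section \<open>Finite expectations and tensorization\<close>

lemma finite_set_Pi_pmf:
  assumes "finite A" "\<And>x. x \<in> A \<Longrightarrow> finite (set_pmf (p x))"
  shows "finite (set_pmf (Pi_pmf A dflt p))"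
  using assms by (auto simp: set_Pi_pmf)

lemma expectation_swap:
  fixes h :: "'a \<Rightarrow> 'b \<Rightarrow> real"
  assumes "finite (set_pmf M)" "finite (set_pmf N)"
  shows "measure_pmf.expectation M (\<lambda>x. measure_pmf.expectation N (h x)) =
    measure_pmf.expectation N (\<lambda>y. measure_pmf.expectation M (\<lambda>x. h x y))"
  by (simp add: integral_measure_pmf_real[OF assms(1)] integral_measure_pmf_real[OF assms(2)]
      sum_distrib_left sum_distrib_right mult_ac sum.swap[of _ "set_pmf M"])

lemma expectation_mono_finite:
  fixes f g :: "'a \<Rightarrow> real"
  assumes "finite (set_pmf M)" "\<And>x. x \<in> set_pmf M \<Longrightarrow> f x \<le> g x"
  shows "measure_pmf.expectation M f \<le> measure_pmf.expectation M g"
  using assms by (intro integral_mono_AE) (auto simp: AE_measure_pmf_iff intro: integrable_measure_pmf_finite)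

lemma expectation_bind_finite:
  fixes h :: "'b \<Rightarrow> real"
  assumes "finite (set_pmf M)" "\<And>x. x \<in> set_pmf M \<Longrightarrow> finite (set_pmf (K x))"
  shows "measure_pmf.expectation (bind_pmf M K) h = measure_pmf.expectation M (\<lambda>x. measure_pmf.expectation (K x) h)"
  using assms by (subst pmf_expectation_bind[OF assms(1)])
    (auto simp: integral_measure_pmf_real[OF assms(1)] mult.commute)

lemma expectation_Pi_pmf_insert:
  fixes h :: "('a \<Rightarrow> 'b) \<Rightarrow> real"
  assumes "finite A" "x \<notin> A" "\<And>i. i \<in> insert x A \<Longrightarrow> finite (set_pmf (p i))"
  shows "measure_pmf.expectation (Pi_pmf (insert x A) dflt p) h =
    measure_pmf.expectation (p x) (\<lambda>y. measure_pmf.expectation (Pi_pmf A dflt p) (\<lambda>P. h (P(x := y))))"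
  using assms by (simp add: Pi_pmf_insert' expectation_bind_finite finite_set_Pi_pmf)

text \<open>Tensorization by induction on the coordinates: with one coordinate frozen, the induction
  hypothesis produces the partial norms \<open>G\<close> and \<open>F\<close>, and
  \<open>base\<close> is then applied to them. Stating the bound bilinearly, with a test function
  \<open>g\<close>, is what makes the two applications compose.\<close>

lemma hypercontractive_Pi_pmf:
  fixes U :: "'a pmf" and V :: "'b pmf" and k :: "'a \<Rightarrow> 'b pmf" and r t :: real
  assumes fin: "finite (set_pmf U)" "finite (set_pmf V)" "\<And>x. finite (set_pmf (k x))"
    and rt: "0 < r" "0 < t"
    and base: "\<And>g f. (\<And>x. 0 \<le> g x) \<Longrightarrow> (\<And>y. 0 \<le> f y) \<Longrightarrow>
      measure_pmf.expectation U (\<lambda>x. g x * measure_pmf.expectation (k x) f) \<le>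
      measure_pmf.expectation U (\<lambda>x. g x powr t) powr (1 / t) *
      measure_pmf.expectation V (\<lambda>y. f y powr r) powr (1 / r)"
    and A: "finite A"
    and nn: "\<And>P. 0 \<le> g P" "\<And>Q. 0 \<le> f Q"
  shows "measure_pmf.expectation (Pi_pmf A a (\<lambda>_. U))
      (\<lambda>P. g P * measure_pmf.expectation (Pi_pmf A b (\<lambda>i. k (P i))) f) \<le>
    measure_pmf.expectation (Pi_pmf A a (\<lambda>_. U)) (\<lambda>P. g P powr t) powr (1 / t) *
    measure_pmf.expectation (Pi_pmf A b (\<lambda>_. V)) (\<lambda>Q. f Q powr r) powr (1 / r)"
  using A nn
proof (induction A arbitrary: g f rule: finite_induct)
  case empty
  then show ?case using rt by (simp add: powr_powr)
next
  case (insert x A)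
  let ?U = "Pi_pmf A a (\<lambda>_. U)" and ?V = "Pi_pmf A b (\<lambda>_. V)" and ?K = "\<lambda>P. Pi_pmf A b (\<lambda>i. k (P i))"
  let ?E = "measure_pmf.expectation"
  define G where "G y = ?E ?U (\<lambda>P. g (P(x := y)) powr t) powr (1 / t)" for y
  define F where "F z = ?E ?V (\<lambda>Q. f (Q(x := z)) powr r) powr (1 / r)" for z
  have Gt: "G y powr t = ?E ?U (\<lambda>P. g (P(x := y)) powr t)" for y
    using rt by (simp add: G_def powr_powr Bochner_Integration.integral_nonneg)
  have Fr: "F z powr r = ?E ?V (\<lambda>Q. f (Q(x := z)) powr r)" for z
    using rt by (simp add: F_def powr_powr Bochner_Integration.integral_nonneg)
  have finU: "finite (set_pmf ?U)" using insert fin by (intro finite_set_Pi_pmf) auto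
  have kernel: "Pi_pmf A b (\<lambda>i. k ((P(x := y)) i)) = ?K P" for P y
    using insert by (intro Pi_pmf_cong) auto
  have "?E (Pi_pmf (insert x A) a (\<lambda>_. U)) (\<lambda>P. g P * ?E (Pi_pmf (insert x A) b (\<lambda>i. k (P i))) f)
    = ?E U (\<lambda>y. ?E ?U (\<lambda>P. g (P(x := y)) * ?E (k y) (\<lambda>z. ?E (?K P) (\<lambda>Q. f (Q(x := z))))))"
    using insert fin by (simp add: expectation_Pi_pmf_insert kernel del: fun_upd_apply) simp
  \<comment> \<open>The kernel at the new coordinate depends on \<open>y\<close> alone, so its
    average moves outside the one over \<open>P\<close>; what remains inside is the induction
    hypothesis for fixed \<open>y\<close> and \<open>z\<close>.\<close>
  also have "\<dots> = ?E U (\<lambda>y. ?E (k y) (\<lambda>z. ?E ?U (\<lambda>P. g (P(x := y)) * ?E (?K P) (\<lambda>Q. f (Q(x := z))))))"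
    by (subst expectation_swap[OF fin(3) finU]) simp
  also have "\<dots> \<le> ?E U (\<lambda>y. ?E (k y) (\<lambda>z. G y * F z))"
    unfolding G_def F_def using fin insert.prems
    by (intro expectation_mono_finite insert.IH) auto
  also have "\<dots> = ?E U (\<lambda>y. G y * ?E (k y) F)"
    by simp
  also have "\<dots> \<le> ?E U (\<lambda>y. G y powr t) powr (1 / t) * ?E V (\<lambda>z. F z powr r) powr (1 / r)"
    by (rule base) (auto simp: G_def F_def)
  also have "\<dots> = ?E (Pi_pmf (insert x A) a (\<lambda>_. U)) (\<lambda>P. g P powr t) powr (1 / t) *
    ?E (Pi_pmf (insert x A) b (\<lambda>_. V)) (\<lambda>Q. f Q powr r) powr (1 / r)"
    unfolding Gt Fr using insert fin by (simp add: expectation_Pi_pmf_insert)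
  finally show ?case .
qed

section \<open>Noise on the cube and the heavy points\<close>

lemma pmf_of_set_hypercube:
  "pmf_of_set (hypercube d) = Pi_pmf {..<d} 0 (\<lambda>_. pmf_of_set {-1, 1})"
  unfolding hypercube_def by (subst Pi_pmf_of_set) auto

lemma finite_hypercube [simp]: "finite (hypercube d)"
  unfolding hypercube_def by auto

lemma hypercube_nonempty [simp]: "hypercube d \<noteq> {}"
  unfolding hypercube_def by simp

lemma finite_set_flip_coordinates [simp]: "finite (set_pmf (flip_coordinates \<delta> d p))"
  unfolding flip_coordinates_def by (intro finite_set_Pi_pmf) auto

text \<open>Flipping with probability \<open>\<delta>\<close> is the noise operator with correlation
  \<open>1 - 2 * \<delta>\<close>. The exponent \<open>t\<close> is conjugate to \<open>s\<close>,
  so this is the dual form of the bound from L^r to L^s.\<close>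

lemma hypercontractive_flip:
  fixes \<delta> r s t :: real
  assumes \<delta>: "0 \<le> \<delta>" "\<delta> \<le> 1 / 2"
    and rs: "1 < r" "r \<le> s" "s < 2" "(1 - 2 * \<delta>)\<^sup>2 * (s - 1) = r - 1" "1 / s + 1 / t = 1"
    and nn: "\<And>p. 0 \<le> g p" "\<And>q. 0 \<le> f q"
  shows "measure_pmf.expectation (pmf_of_set (hypercube d))
      (\<lambda>p. g p * measure_pmf.expectation (flip_coordinates \<delta> d p) f) \<le>
    measure_pmf.expectation (pmf_of_set (hypercube d)) (\<lambda>p. g p powr t) powr (1 / t) *
    measure_pmf.expectation (pmf_of_set (hypercube d)) (\<lambda>q. f q powr r) powr (1 / r)"
proof -
  have "0 < 1 / s" "1 / s < 1" using rs by auto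
  then have "1 / t < 1" "1 / t > 0" using rs by linarith+
  then have t: "1 < t" by (simp add: zero_less_divide_iff divide_less_eq_1)
  have base: "measure_pmf.expectation (pmf_of_set {-1, 1 :: int})
      (\<lambda>x. g x * measure_pmf.expectation (map_pmf (\<lambda>flip. if flip then - x else x) (bernoulli_pmf \<delta>)) f)
    \<le> measure_pmf.expectation (pmf_of_set {-1, 1}) (\<lambda>x. g x powr t) powr (1 / t) *
      measure_pmf.expectation (pmf_of_set {-1, 1}) (\<lambda>y. f y powr r) powr (1 / r)"
    if nn: "\<And>x. 0 \<le> g x" "\<And>y. 0 \<le> f y" for g f :: "int \<Rightarrow> real"
  proof -
    \<comment> \<open>These are the noise averages of \<open>f\<close> at 1 and -1: the two-point
      inequality bounds their L^s norm, and Holder's inequality pairs them with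
      \<open>g\<close>.\<close>
    define u v where "u = (1 - \<delta>) * f 1 + \<delta> * f (- 1)" and "v = \<delta> * f 1 + (1 - \<delta>) * f (- 1)"
    have uv: "0 \<le> u" "0 \<le> v" using nn \<delta> by (auto simp: u_def v_def)
    have "(u powr s + v powr s) / 2 \<le> ((f 1 powr r + f (- 1) powr r) / 2) powr (s / r)"
    proof -
      have "(1 + (1 - 2 * \<delta>)) / 2 = 1 - \<delta>" "(1 - (1 - 2 * \<delta>)) / 2 = \<delta>" by simp_all
      then show ?thesis
        using two_point_hypercontractive[OF rs(1-4), of "f 1" "f (- 1)"] \<delta> nn
        unfolding u_def v_def by (simp only:)
    qed
    then have "((u powr s + v powr s) / 2) powr (1 / s) \<le> (((f 1 powr r + f (- 1) powr r) / 2) powr (s / r)) powr (1 / s)"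
      using rs by (intro powr_mono2) auto
    also have "\<dots> = ((f 1 powr r + f (- 1) powr r) / 2) powr (1 / r)"
      using rs by (simp add: powr_powr)
    finally have *: "((u powr s + v powr s) / 2) powr (1 / s) \<le> ((f 1 powr r + f (- 1) powr r) / 2) powr (1 / r)" .
    have "(g 1 * u + g (- 1) * v) / 2 \<le> ((g 1 powr t + g (- 1) powr t) / 2) powr (1 / t) * ((u powr s + v powr s) / 2) powr (1 / s)"
      using nn uv rs t by (intro Holder_two_points) auto
    also have "\<dots> \<le> ((g 1 powr t + g (- 1) powr t) / 2) powr (1 / t) * ((f 1 powr r + f (- 1) powr r) / 2) powr (1 / r)"
      by (rule mult_left_mono[OF *]) simp
    finally show ?thesis
      using \<delta> by (simp add: integral_pmf_of_set u_def v_def add.commute mult.commute)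
  qed
  show ?thesis
    unfolding pmf_of_set_hypercube flip_coordinates_def
    using rs t nn by (intro hypercontractive_Pi_pmf base) auto
qed

text \<open>The bilinear inequality is tested on two indicators, that of \<open>Q\<close> and that
  of the points whose noise hits \<open>Q\<close> with probability at least \<open>\<tau>\<close>.
  Markov's inequality then replaces the unknown measure of the latter set.\<close>

lemma heavy_noise_expectation:
  fixes \<delta> r s \<tau> :: real and Q :: "point set"
  assumes \<delta>: "0 \<le> \<delta>" "\<delta> \<le> 1 / 2"
    and rs: "1 < r" "r \<le> s" "s < 2" "(1 - 2 * \<delta>)\<^sup>2 * (s - 1) = r - 1"
    and \<tau>: "0 < \<tau>"
  shows "measure_pmf.expectation (pmf_of_set (hypercube d))
      (\<lambda>p. indicator {p. \<tau> \<le> measure_pmf.prob (flip_coordinates \<delta> d p) Q} p *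
        measure_pmf.prob (flip_coordinates \<delta> d p) Q)
    \<le> measure_pmf.prob (pmf_of_set (hypercube d)) Q powr (s / r) * \<tau> powr (1 - s)"
proof -
  define U where "U = pmf_of_set (hypercube d)"
  define \<phi> where "\<phi> p = measure_pmf.prob (flip_coordinates \<delta> d p) Q" for p
  define B where "B = {p. \<tau> \<le> \<phi> p}"
  define X where "X = measure_pmf.expectation U (\<lambda>p. indicator B p * \<phi> p)"
  define t where "t = s / (s - 1)"
  have st: "1 / s + 1 / t = 1" "t > 0" "s > 1" using rs by (auto simp: t_def field_simps)
  have fin: "finite (set_pmf U)" unfolding U_def by simp
  have X0: "0 \<le> X" unfolding X_def \<phi>_def by (intro Bochner_Integration.integral_nonneg) auto
  have ind: "(\<lambda>x. indicator S x powr e) = (indicator S :: _ \<Rightarrow> real)" for S :: "point set" and e :: real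
    by (auto simp: indicator_def)
  have "\<tau> * measure_pmf.prob U B = measure_pmf.expectation U (\<lambda>p. indicator B p * \<tau>)"
    by simp
  also have "\<dots> \<le> X"
    unfolding X_def by (intro expectation_mono_finite fin) (auto simp: B_def indicator_def)
  \<comment> \<open>The measure of \<open>B\<close> is bounded by \<open>X\<close> itself, so that \<open>X\<close> appears on both sides of
    the hypercontractive estimate, with exponent below 1 on the right.\<close>
  finally have markov: "measure_pmf.prob U B \<le> X / \<tau>"
    using \<tau> by (simp add: pos_le_divide_eq mult.commute)
  have "X \<le> measure_pmf.prob U B powr (1 / t) * measure_pmf.prob U Q powr (1 / r)"
    using hypercontractive_flip[OF \<delta> rs st(1), of "indicator B" "indicator Q" d]
    by (simp add: ind X_def \<phi>_def U_def)
  also have "\<dots> \<le> (X / \<tau>) powr (1 / t) * measure_pmf.prob U Q powr (1 / r)"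
    using markov st by (intro mult_right_mono powr_mono2) auto
  finally have le: "X \<le> (X / \<tau>) powr (1 / t) * measure_pmf.prob U Q powr (1 / r)" .
  have "X \<le> measure_pmf.prob U Q powr (s / r) * \<tau> powr (1 - s)"
  proof (cases "X = 0")
    case False
    then have X: "X > 0" using X0 by simp
    define \<mu> where "\<mu> = measure_pmf.prob U Q"
    \<comment> \<open>Raising to the power \<open>s\<close> leaves \<open>X\<close> with exponent
      \<open>s / t = s - 1\<close> on the right, so exactly one factor \<open>X\<close> survives
      cancellation.\<close>
    have "X powr s \<le> ((X / \<tau>) powr (1 / t) * \<mu> powr (1 / r)) powr s"
      using le X st by (intro powr_mono2) (auto simp: \<mu>_def)
    also have "\<dots> = (X / \<tau>) powr (s / t) * \<mu> powr (s / r)"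
      by (simp add: powr_mult powr_powr)
    also have "s / t = s - 1" using st by (simp add: t_def)
    also have "(X / \<tau>) powr (s - 1) * \<mu> powr (s / r) = X powr (s - 1) * (\<mu> powr (s / r) * \<tau> powr (1 - s))"
      using X \<tau> by (simp add: powr_divide powr_diff mult_ac)
    finally have "X powr (s - 1) * X \<le> X powr (s - 1) * (\<mu> powr (s / r) * \<tau> powr (1 - s))"
      using X powr_add[of X "s - 1" 1] by simp
    then show ?thesis
      unfolding \<mu>_def using X by (simp add: mult_le_cancel_left)
  qed simp
  then show ?thesis
    unfolding X_def U_def B_def \<phi>_def .
qed

section \<open>Points recovered from a single cell\<close>

lemma exp_le_one_plus_twice:
  fixes x :: real
  assumes "0 \<le> x" "x \<le> 1"
  shows "exp x \<le> 1 + 2 * x"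
  using exp_bound[OF assms] power2_eq_square[of x] mult_left_le[of x x] assms by simp

text \<open>The label may depend on all the points, which destroys independence. The exponential of
  the chosen sum is therefore bounded by the total over all labels; for each fixed label the
  exponential moment factorizes, and the number of labels enters only through its logarithm.\<close>

lemma expectation_best_label:
  fixes h :: "'x \<Rightarrow> 'a \<Rightarrow> real" and \<tau> \<beta> :: real
  assumes fin: "finite (set_pmf U)" "finite I" "finite X" "X \<noteq> {}"
    and L: "\<And>P. P \<in> set_pmf (Pi_pmf I dflt (\<lambda>_. U)) \<Longrightarrow> L P \<in> X"
    and \<tau>: "0 < \<tau>" and h: "\<And>x p. x \<in> X \<Longrightarrow> 0 \<le> h x p" "\<And>x p. x \<in> X \<Longrightarrow> h x p \<le> \<tau>"
    and \<beta>: "\<And>x. x \<in> X \<Longrightarrow> measure_pmf.expectation U (h x) \<le> \<beta>"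
  shows "measure_pmf.expectation (Pi_pmf I dflt (\<lambda>_. U)) (\<lambda>P. \<Sum>i\<in>I. h (L P) (P i))
    \<le> \<tau> * (ln (card X) + exp (2 * card I * \<beta> / \<tau>) - 1)"
proof -
  let ?M = "Pi_pmf I dflt (\<lambda>_. U)" and ?E = "measure_pmf.expectation"
  define K where "K = real (card X)"
  have K: "K > 0" using fin by (simp add: K_def card_gt_0_iff)
  define S where "S x P = (\<Sum>i\<in>I. h x (P i) / \<tau>)" for x P
  have finM: "finite (set_pmf ?M)" using fin by (intro finite_set_Pi_pmf) auto
  have int: "integrable ?M f" for f :: "_ \<Rightarrow> real"
    by (rule integrable_measure_pmf_finite[OF finM])
  have intU: "integrable U f" for f :: "_ \<Rightarrow> real"
    by (rule integrable_measure_pmf_finite[OF fin(1)])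
  have mgf: "?E ?M (\<lambda>P. exp (S x P)) \<le> exp (2 * card I * \<beta> / \<tau>)" if x: "x \<in> X" for x
  proof -
    have "?E ?M (\<lambda>P. exp (S x P)) = ?E ?M (\<lambda>P. \<Prod>i\<in>I. exp (h x (P i) / \<tau>))"
      using fin by (simp add: S_def exp_sum)
    also have "\<dots> = (\<Prod>i\<in>I. ?E U (\<lambda>p. exp (h x p / \<tau>)))"
      using fin by (intro expectation_prod_Pi_pmf intU) auto
    also have "\<dots> \<le> (\<Prod>i\<in>I. exp (2 * \<beta> / \<tau>))"
    proof (intro prod_mono conjI)
      \<comment> \<open>Truncation at \<open>\<tau>\<close> puts the exponent in [0, 1], where the
        exponential is bounded linearly; hence only the mean of \<open>h x\<close> enters.\<close>
      have "?E U (\<lambda>p. exp (h x p / \<tau>)) \<le> ?E U (\<lambda>p. 1 + 2 * (h x p / \<tau>))"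
        using h[OF x] \<tau> by (intro expectation_mono_finite fin exp_le_one_plus_twice) auto
      also have "\<dots> = 1 + 2 * (?E U (h x) / \<tau>)"
        by (simp add: Bochner_Integration.integral_add[OF intU intU])
      also have "\<dots> \<le> 1 + 2 * \<beta> / \<tau>"
        using \<beta>[OF x] \<tau> by (simp add: divide_right_mono)
      also have "\<dots> \<le> exp (2 * \<beta> / \<tau>)"
        by (rule exp_ge_add_one_self)
      finally show "?E U (\<lambda>p. exp (h x p / \<tau>)) \<le> exp (2 * \<beta> / \<tau>)" .
    qed (auto intro: Bochner_Integration.integral_nonneg)
    also have "\<dots> = exp (2 * card I * \<beta> / \<tau>)"
      by (simp add: exp_of_nat_mult[symmetric] mult_ac)
    finally show ?thesis .
  qed
  \<comment> \<open>The tangent of \<open>ln\<close> at \<open>K\<close> plays the role of Jensen's inequality.\<close>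
  have pointwise: "S (L P) P \<le> ln K + (\<Sum>x\<in>X. exp (S x P)) / K - 1" if "P \<in> set_pmf ?M" for P
  proof -
    have "S (L P) P - ln K = ln (exp (S (L P) P) / K)"
      using K by (simp add: ln_div)
    also have "\<dots> \<le> exp (S (L P) P) / K - 1"
      using K by (intro ln_le_minus_one) simp
    also have "exp (S (L P) P) \<le> (\<Sum>x\<in>X. exp (S x P))"
      using L[OF that] fin by (intro member_le_sum) auto
    finally show ?thesis using K by (simp add: divide_right_mono)
  qed
  have "?E ?M (\<lambda>P. \<Sum>i\<in>I. h (L P) (P i)) = \<tau> * ?E ?M (\<lambda>P. S (L P) P)"
    using \<tau> by (simp add: S_def sum_divide_distrib[symmetric])
  also have "?E ?M (\<lambda>P. S (L P) P) \<le> ?E ?M (\<lambda>P. ln K - 1 + (\<Sum>x\<in>X. exp (S x P)) / K)"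
    using pointwise by (intro expectation_mono_finite finM) (simp add: algebra_simps)
  also have "\<dots> = ln K - 1 + (\<Sum>x\<in>X. ?E ?M (\<lambda>P. exp (S x P))) / K"
    by (simp add: Bochner_Integration.integral_add[OF int int] Bochner_Integration.integral_sum[OF int])
  also have "(\<Sum>x\<in>X. ?E ?M (\<lambda>P. exp (S x P))) \<le> (\<Sum>x\<in>X. exp (2 * card I * \<beta> / \<tau>))"
    by (intro sum_mono mgf)
  finally show ?thesis
    using K \<tau> by (simp add: K_def divide_right_mono mult_left_mono algebra_simps)
qed

section \<open>Guessing the planted point from the query\<close>

lemma pmf_flip_coordinates_le:
  assumes "p \<in> hypercube d" "0 \<le> \<delta>" "\<delta> \<le> 1 / 2"
  shows "pmf (flip_coordinates \<delta> d p) q \<le> (1 - \<delta>) ^ d"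
proof -
  have coord: "pmf (map_pmf (\<lambda>b. if b then - x else x) (bernoulli_pmf \<delta>)) y \<le> 1 - \<delta>"
    if "x \<in> {-1, 1}" for x y :: int
  proof -
    let ?f = "\<lambda>b. if b then - x else x"
    have "inj ?f" using that by (auto simp: inj_def)
    then have image: "pmf (map_pmf ?f (bernoulli_pmf \<delta>)) (?f b) = pmf (bernoulli_pmf \<delta>) b" for b
      by (rule pmf_map_inj')
    show ?thesis
    proof (cases "y \<in> range ?f")
      case True
      then obtain b where b: "y = ?f b" by blast
      have "pmf (bernoulli_pmf \<delta>) b \<le> 1 - \<delta>"
        using assms(2,3) by (cases b) simp_all
      then show ?thesis unfolding b image .
    next
      case False
      then have "pmf (map_pmf ?f (bernoulli_pmf \<delta>)) y = 0"
        by (auto simp: pmf_eq_0_set_pmf)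
      then show ?thesis using assms(2,3) by simp
    qed
  qed
  \<comment> \<open>No value of a coordinate is likelier than the unflipped one, as
    \<open>\<delta> \<le> 1 / 2\<close>.\<close>
  have "(\<Prod>i<d. pmf (map_pmf (\<lambda>b. if b then - p i else p i) (bernoulli_pmf \<delta>)) (q i)) \<le> (\<Prod>i<d. 1 - \<delta>)"
    using assms(1) by (intro prod_mono conjI coord) (auto simp: hypercube_def PiE_dflt_def)
  then show ?thesis
    using assms(2,3) by (auto simp: flip_coordinates_def pmf_Pi)
qed

lemma set_pmf_flip_coordinates:
  "p \<in> hypercube d \<Longrightarrow> set_pmf (flip_coordinates \<delta> d p) \<subseteq> hypercube d"
  by (fastforce simp: flip_coordinates_def hypercube_def set_Pi_pmf PiE_dflt_def)

text \<open>Summing over \<open>q\<close> first by double counting: each query in \<open>Q\<close>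
  names a single point \<open>a q\<close>, and the noise carries that point to \<open>q\<close> with
  probability at most \<open>(1 - \<delta>) ^ d\<close>. With fixed contents a cell thus recovers a
  random point very rarely.\<close>

lemma guess_probability_le:
  assumes "0 \<le> \<delta>" "\<delta> \<le> 1 / 2"
  shows "measure_pmf.expectation (pmf_of_set (hypercube d))
      (\<lambda>p. measure_pmf.prob (flip_coordinates \<delta> d p) {q \<in> Q. a q = p})
    \<le> measure_pmf.prob (pmf_of_set (hypercube d)) Q * (1 - \<delta>) ^ d"
proof -
  let ?H = "hypercube d"
  have eta: "0 \<le> (1 - \<delta>) ^ d" using assms by simp
  have "measure_pmf.expectation (pmf_of_set ?H) (\<lambda>p. measure_pmf.prob (flip_coordinates \<delta> d p) {q \<in> Q. a q = p})
    = (\<Sum>p\<in>?H. measure_pmf.prob (flip_coordinates \<delta> d p) {q \<in> Q. a q = p}) / card ?H"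
    by (simp add: integral_pmf_of_set)
  also have "(\<Sum>p\<in>?H. measure_pmf.prob (flip_coordinates \<delta> d p) {q \<in> Q. a q = p})
    = (\<Sum>p\<in>?H. \<Sum>q\<in>?H. indicator {q \<in> Q. a q = p} q * pmf (flip_coordinates \<delta> d p) q)"
  proof (rule sum.cong[OF refl])
    fix p assume p: "p \<in> ?H"
    have "measure_pmf.prob (flip_coordinates \<delta> d p) {q \<in> Q. a q = p} =
      measure_pmf.expectation (flip_coordinates \<delta> d p) (indicator {q \<in> Q. a q = p})" by simp
    also have "\<dots> = (\<Sum>q\<in>?H. indicator {q \<in> Q. a q = p} q * pmf (flip_coordinates \<delta> d p) q)"
      using set_pmf_flip_coordinates[OF p] by (intro integral_measure_pmf_real) auto
    finally show "measure_pmf.prob (flip_coordinates \<delta> d p) {q \<in> Q. a q = p} = \<dots>" .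
  qed
  also have "\<dots> = (\<Sum>q\<in>?H. \<Sum>p\<in>?H. indicator {q \<in> Q. a q = p} q * pmf (flip_coordinates \<delta> d p) q)"
    by (rule sum.swap)
  also have "\<dots> \<le> (\<Sum>q\<in>?H. indicator Q q * (1 - \<delta>) ^ d)"
  proof (rule sum_mono)
    fix q
    have "(\<Sum>p\<in>?H. indicator {q \<in> Q. a q = p} q * pmf (flip_coordinates \<delta> d p) q)
      \<le> (\<Sum>p\<in>?H. if p = a q then indicator Q q * (1 - \<delta>) ^ d else 0)"
      using pmf_flip_coordinates_le[OF _ assms] by (intro sum_mono) (auto simp: indicator_def)
    \<comment> \<open>Only an inequality, because \<open>a q\<close> may lie outside the cube, in
      which case the sum is zero.\<close>
    also have "\<dots> \<le> indicator Q q * (1 - \<delta>) ^ d"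
      using eta by simp
    finally show "(\<Sum>p\<in>?H. indicator {q \<in> Q. a q = p} q * pmf (flip_coordinates \<delta> d p) q) \<le> indicator Q q * (1 - \<delta>) ^ d" .
  qed
  also have "\<dots> = card (?H \<inter> Q) * (1 - \<delta>) ^ d"
    using sum.inter_restrict[OF finite_hypercube, of "\<lambda>_. 1 :: real" d Q]
    by (simp add: sum_distrib_right[symmetric] indicator_def of_bool_def)
  finally show ?thesis
    by (simp add: measure_pmf_of_set divide_right_mono)
qed

section \<open>Success probability as a sum over cells\<close>

lemma set_pmf_random_dataset:
  "set_pmf (random_dataset n d) = PiE_dflt {..<n} (\<lambda>_. 0) (\<lambda>_. hypercube d)"
  by (simp add: random_dataset_def set_Pi_pmf o_def)

text \<open>Every query probes exactly one cell, so success splits disjointly by address; the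
  division by \<open>n\<close> is the uniform choice of the planted index.\<close>

lemma single_probe_success_eq:
  assumes n: "0 < n" and S: "uses_cells n d m w S"
  shows "measure_pmf.prob (hamming_random_instance c n d) {(P, p, q). run_query S P q = p} =
    (\<Sum>j<m. measure_pmf.expectation (random_dataset n d) (\<lambda>P. \<Sum>i<n.
      measure_pmf.prob (flip_coordinates (1 / (2 * c)) d (P i))
        {q \<in> {q. address S q = j}. answer S q (cells S P j) = P i})) / n"
proof -
  let ?E = "measure_pmf.expectation"
  let ?N = "flip_coordinates (1 / (2 * c)) d"
  let ?h = "\<lambda>j P i. measure_pmf.prob (?N (P i)) {q \<in> {q. address S q = j}. answer S q (cells S P j) = P i}"
  have finM: "finite (set_pmf (random_dataset n d))"
    unfolding random_dataset_def by (intro finite_set_Pi_pmf) auto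
  have cells_split: "measure_pmf.prob (?N (P i)) {q. run_query S P q = P i} = (\<Sum>j<m. ?h j P i)"
    if P: "P \<in> set_pmf (random_dataset n d)" and i: "i < n" for P i
  proof -
    have "P i \<in> hypercube d"
      using P i by (auto simp: set_pmf_random_dataset PiE_dflt_def)
    then have addr: "address S q < m" if "q \<in> set_pmf (?N (P i))" for q
      using set_pmf_flip_coordinates S that unfolding uses_cells_def by blast
    have "measure_pmf.prob (?N (P i)) {q. run_query S P q = P i} = ?E (?N (P i)) (indicator {q. run_query S P q = P i})"
      by simp
    \<comment> \<open>Addresses are known to be below \<open>m\<close> only on the cube, so the
      indicators are compared on the support of the noise.\<close>
    also have "\<dots> = ?E (?N (P i)) (\<lambda>q. \<Sum>j<m. indicator {q \<in> {q. address S q = j}. answer S q (cells S P j) = P i} q)"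
    proof (intro integral_cong_AE AE_pmfI)
      fix q assume "q \<in> set_pmf (?N (P i))"
      then have "address S q < m" by (rule addr)
      have "(\<Sum>j<m. indicator {q \<in> {q. address S q = j}. answer S q (cells S P j) = P i} q :: real)
        = (\<Sum>j<m. if j = address S q then indicator {q. run_query S P q = P i} q else 0)"
        by (intro sum.cong) (auto simp: indicator_def run_query_def)
      then show "indicator {q. run_query S P q = P i} q =
          (\<Sum>j<m. indicator {q \<in> {q. address S q = j}. answer S q (cells S P j) = P i} q :: real)"
        using \<open>address S q < m\<close> by simp
    qed auto
    also have "\<dots> = (\<Sum>j<m. ?h j P i)"
      by (subst Bochner_Integration.integral_sum) (auto intro: integrable_measure_pmf_finite)
    finally show ?thesis .
  qed
  have "finite (set_pmf (pmf_of_set {..<n}))" using n by (subst set_pmf_of_set) auto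
  then have instance_expectation: "?E (hamming_random_instance c n d) f = ?E (random_dataset n d) (\<lambda>P. ?E (pmf_of_set {..<n})
      (\<lambda>i. ?E (?N (P i)) (\<lambda>q. f (P, P i, q))))" for f :: "_ \<Rightarrow> real"
    unfolding hamming_random_instance_def using finM by (simp add: expectation_bind_finite)
  have "measure_pmf.prob (hamming_random_instance c n d) {(P, p, q). run_query S P q = p}
    = ?E (hamming_random_instance c n d) (indicator {(P, p, q). run_query S P q = p})"
    by simp
  also have "\<dots> = ?E (random_dataset n d) (\<lambda>P. ?E (pmf_of_set {..<n})
      (\<lambda>i. ?E (?N (P i)) (\<lambda>q. indicator {(P, p, q). run_query S P q = p} (P, P i, q))))"
    by (rule instance_expectation)
  also have "\<dots> = ?E (random_dataset n d) (\<lambda>P. ?E (pmf_of_set {..<n})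
      (\<lambda>i. measure_pmf.prob (?N (P i)) {q. run_query S P q = P i}))"
  proof -
    have "(\<lambda>q. indicator {(P, p, q). run_query S P q = p} (P, P i, q)) = (indicator {q. run_query S P q = P i} :: _ \<Rightarrow> real)" for P i
      by (auto simp: indicator_def)
    then show ?thesis by simp
  qed
  also have "\<dots> = ?E (random_dataset n d) (\<lambda>P. (\<Sum>i<n. measure_pmf.prob (?N (P i)) {q. run_query S P q = P i}) / n)"
    using n by (subst integral_pmf_of_set) auto
  also have "\<dots> = ?E (random_dataset n d) (\<lambda>P. (\<Sum>j<m. \<Sum>i<n. ?h j P i) / n)"
    by (intro integral_cong_AE AE_pmfI) (simp_all add: cells_split sum.swap[of _ "{..<m}"])
  also have "\<dots> = (\<Sum>j<m. ?E (random_dataset n d) (\<lambda>P. \<Sum>i<n. ?h j P i)) / n"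
    by (simp add: Bochner_Integration.integral_sum integrable_measure_pmf_finite[OF finM])
  finally show ?thesis .
qed

text \<open>Points are split by whether they probe the cell with probability at least
  \<open>\<tau>\<close>. Light points fall under the best-label bound with the cell contents as
  label; for heavy points the answer is ignored and hypercontractivity bounds the probing
  probability itself.\<close>

lemma cell_success_le:
  fixes c r s \<tau> :: real
  assumes c: "1 < c"
    and rs: "1 < r" "r \<le> s" "s < 2" "(1 - 1 / c)\<^sup>2 * (s - 1) = r - 1"
    and S: "uses_cells n d m w S" and j: "j < m" and \<tau>: "0 < \<tau>"
    and \<mu>: "\<mu> = measure_pmf.prob (pmf_of_set (hypercube d)) {q. address S q = j}"
    and small: "exp (2 * real n * (\<mu> * (1 - 1 / (2 * c)) ^ d) / \<tau>) \<le> 2"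
  shows "measure_pmf.expectation (random_dataset n d) (\<lambda>P. \<Sum>i<n.
      measure_pmf.prob (flip_coordinates (1 / (2 * c)) d (P i))
        {q \<in> {q. address S q = j}. answer S q (cells S P j) = P i})
    \<le> \<tau> * (real w + 1) + n * (\<mu> powr (s / r) * \<tau> powr (1 - s))"
proof -
  let ?E = "measure_pmf.expectation" and ?\<delta> = "1 / (2 * c)"
  let ?N = "flip_coordinates (1 / (2 * c)) d"
  let ?Q = "{q. address S q = j}"
  have \<delta>: "0 \<le> ?\<delta>" "?\<delta> \<le> 1 / 2" using c by simp_all
  define U where "U = pmf_of_set (hypercube d)"
  have finU: "finite (set_pmf U)" by (simp add: U_def)
  have M: "random_dataset n d = Pi_pmf {..<n} (\<lambda>_. 0) (\<lambda>_. U)" by (simp add: random_dataset_def U_def)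
  have finM: "finite (set_pmf (random_dataset n d))"
    unfolding M using finU by (intro finite_set_Pi_pmf) auto
  have intM: "integrable (random_dataset n d) f" for f :: "_ \<Rightarrow> real"
    by (rule integrable_measure_pmf_finite[OF finM])
  have intU: "integrable U f" for f :: "_ \<Rightarrow> real"
    by (rule integrable_measure_pmf_finite[OF finU])
  define \<phi> where "\<phi> p = measure_pmf.prob (?N p) ?Q" for p
  define B where "B = {p. \<tau> \<le> \<phi> p}"
  define h where "h x p = measure_pmf.prob (?N p) {q \<in> ?Q. answer S q x = p}" for x p
  define light where "light x p = (if p \<in> B then 0 else h x p)" for x p
  define X where "X = {x :: bool list. length x = w}"
  have X: "finite X" "card X = 2 ^ w"
    using finite_lists_length_eq[of "UNIV :: bool set" w] card_lists_length_eq[of "UNIV :: bool set" w]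
    by (simp_all add: X_def)
  have h_le: "h x p \<le> \<phi> p" for x p
    unfolding h_def \<phi>_def by (intro measure_pmf.finite_measure_mono) auto
  have "?E (random_dataset n d) (\<lambda>P. \<Sum>i<n. h (cells S P j) (P i))
    \<le> ?E (random_dataset n d) (\<lambda>P. (\<Sum>i<n. light (cells S P j) (P i)) + (\<Sum>i<n. indicator B (P i) * \<phi> (P i)))"
    unfolding sum.distrib[symmetric]
    by (intro expectation_mono_finite finM sum_mono) (auto simp: light_def h_le)
  also have "\<dots> = ?E (random_dataset n d) (\<lambda>P. \<Sum>i<n. light (cells S P j) (P i)) +
      ?E (random_dataset n d) (\<lambda>P. \<Sum>i<n. indicator B (P i) * \<phi> (P i))"
    by (rule Bochner_Integration.integral_add[OF intM intM])
  also have "\<dots> \<le> \<tau> * (real w + 1) + n * (\<mu> powr (s / r) * \<tau> powr (1 - s))"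
  proof (rule add_mono)
    have "?E (random_dataset n d) (\<lambda>P. \<Sum>i<n. light (cells S P j) (P i))
      \<le> \<tau> * (ln (card X) + exp (2 * card {..<n} * (\<mu> * (1 - ?\<delta>) ^ d) / \<tau>) - 1)"
      unfolding M
    proof (rule expectation_best_label)
      fix P assume "P \<in> set_pmf (Pi_pmf {..<n} (\<lambda>_. 0) (\<lambda>_. U))"
      then show "cells S P j \<in> X"
        using S j by (auto simp: M[symmetric] set_pmf_random_dataset uses_cells_def X_def)
    next
      fix x
      have "?E U (light x) \<le> ?E U (h x)"
        by (intro expectation_mono_finite finU) (auto simp: light_def h_def)
      also have "\<dots> \<le> \<mu> * (1 - ?\<delta>) ^ d"
        unfolding h_def U_def \<mu> by (rule guess_probability_le[OF \<delta>])
      finally show "?E U (light x) \<le> \<mu> * (1 - ?\<delta>) ^ d" .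
      show "light x p \<le> \<tau>" for p
        using h_le[of x p] \<tau> by (auto simp: light_def B_def)
      show "0 \<le> light x p" for p
        by (auto simp: light_def h_def)
    qed (use finU X \<tau> in \<open>auto simp: X_def intro: exI[of _ "replicate w True"]\<close>)
    also have "\<dots> \<le> \<tau> * (real w + 1)"
    proof (rule mult_left_mono)
      \<comment> \<open>There are 2^w contents, which cost at most \<open>w\<close> since ln 2 < 1;
        by \<open>small\<close> the exponential exceeds 1 by at most 1, whence
        \<open>w + 1\<close>.\<close>
      have "ln (real (card X)) = w * ln 2" by (simp add: X ln_realpow)
      also have "\<dots> \<le> real w * 1" using ln_le_minus_one[of 2] by (intro mult_left_mono) auto
      finally show "ln (real (card X)) + exp (2 * card {..<n} * (\<mu> * (1 - ?\<delta>) ^ d) / \<tau>) - 1 \<le> real w + 1"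
        using small by simp
    qed (use \<tau> in simp)
    finally show "?E (random_dataset n d) (\<lambda>P. \<Sum>i<n. light (cells S P j) (P i)) \<le> \<tau> * (real w + 1)" .
    \<comment> \<open>Whether a point is heavy is decided by the address function alone, not by the
      contents, so linearity of expectation suffices here.\<close>
    have "?E (random_dataset n d) (\<lambda>P. \<Sum>i<n. indicator B (P i) * \<phi> (P i)) = n * ?E U (\<lambda>p. indicator B p * \<phi> p)"
    proof -
      have "?E (random_dataset n d) (\<lambda>P. f (P i)) = ?E U f" if "i < n" for i and f :: "_ \<Rightarrow> real"
      proof -
        have "?E (random_dataset n d) (\<lambda>P. f (P i)) = ?E (map_pmf (\<lambda>P. P i) (random_dataset n d)) f"
          by simp
        also have "map_pmf (\<lambda>P. P i) (random_dataset n d) = U"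
          unfolding M using that by (subst Pi_pmf_component) auto
        finally show ?thesis .
      qed
      from this[of _ "\<lambda>p. indicator B p * \<phi> p"] show ?thesis
        by (subst Bochner_Integration.integral_sum[OF intM]) simp
    qed
    also have "\<dots> \<le> n * (\<mu> powr (s / r) * \<tau> powr (1 - s))"
      unfolding U_def B_def \<phi>_def \<mu>
      by (intro mult_left_mono heavy_noise_expectation \<delta> rs(1-3) \<tau>) (use rs in simp_all)
    finally show "?E (random_dataset n d) (\<lambda>P. \<Sum>i<n. indicator B (P i) * \<phi> (P i)) \<le> n * (\<mu> powr (s / r) * \<tau> powr (1 - s))" .
  qed
  finally show ?thesis unfolding h_def .
qed

lemma single_probe_success_le:
  fixes c r s :: real
  assumes c: "1 < c"
    and rs: "1 < r" "r \<le> s" "s < 2" "(1 - 1 / c)\<^sup>2 * (s - 1) = r - 1"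
    and n: "0 < n" and S: "uses_cells n d m w S"
    and small: "exp (40 * (real w + 1) * (1 - 1 / (2 * c)) ^ d) \<le> 2"
  shows "0 < m" and "measure_pmf.prob (hamming_random_instance c n d) {(P, p, q). run_query S P q = p}
    \<le> 1 / 10 + real m powr (s - s / r) * (20 * (real w + 1) / n) powr (s - 1)"
proof -
  obtain q where q: "q \<in> hypercube d" using hypercube_nonempty by blast
  then show m: "0 < m" using S by (auto simp: uses_cells_def intro: gr_zeroI)
  define \<eta> where "\<eta> = (1 - 1 / (2 * c)) ^ d"
  have \<eta>: "0 \<le> \<eta>" using c by (simp add: \<eta>_def)
  define T where "T = 20 * (real w + 1) / n"
  have T: "T > 0" using n by (simp add: T_def)
  define \<mu> where "\<mu> j = measure_pmf.prob (pmf_of_set (hypercube d)) {q. address S q = j}" for j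
  \<comment> \<open>The summand \<open>1 / m\<close> keeps the threshold positive for cells that are
    never probed. The numerators add up to 2, so the factor 20 in \<open>T\<close> makes the light
    points contribute exactly 1/10.\<close>
  define \<tau> where "\<tau> j = (\<mu> j + 1 / m) / T" for j
  have \<mu>0: "0 \<le> \<mu> j" for j by (simp add: \<mu>_def)
  have \<tau>: "\<tau> j > 0" for j using \<mu>0[of j] T m by (auto simp: \<tau>_def intro!: divide_pos_pos add_nonneg_pos)
  have \<mu>_sum: "(\<Sum>j<m. \<mu> j) = 1"
  proof -
    have "(\<Sum>j<m. \<mu> j) = measure_pmf.prob (pmf_of_set (hypercube d)) (\<Union>j<m. {q. address S q = j})"
      unfolding \<mu>_def by (intro measure_pmf.finite_measure_finite_Union[symmetric]) (auto simp: disjoint_family_on_def)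
    also have "\<dots> = 1"
      using S by (subst measure_pmf.prob_eq_1) (auto simp: AE_measure_pmf_iff uses_cells_def)
    finally show ?thesis .
  qed
  \<comment> \<open>The measure of the cell cancels up to a ratio at most 1, so one smallness
    hypothesis serves all cells.\<close>
  have small': "exp (2 * real n * (\<mu> j * \<eta>) / \<tau> j) \<le> 2" for j
  proof -
    have "\<mu> j / (\<mu> j + 1 / m) \<le> 1"
      using \<mu>0[of j] m by (intro divide_le_eq_1[THEN iffD2]) (auto intro!: add_nonneg_pos)
    then have "\<mu> j / (\<mu> j + 1 / m) * (40 * (real w + 1) * \<eta>) \<le> 1 * (40 * (real w + 1) * \<eta>)"
      using \<eta> by (intro mult_right_mono) auto
    moreover have "2 * real n * (\<mu> j * \<eta>) / \<tau> j = \<mu> j / (\<mu> j + 1 / m) * (40 * (real w + 1) * \<eta>)"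
      using n by (simp add: \<tau>_def T_def)
    ultimately show ?thesis
      using small by (smt (verit) \<eta>_def exp_le_cancel_iff)
  qed
  have large: "\<mu> j powr (s / r) * \<tau> j powr (1 - s) \<le> \<mu> j * (real m powr (s - s / r) * T powr (s - 1))" for j
  proof (cases "\<mu> j = 0")
    case False
    define x where "x = \<mu> j + 1 / m"
    have \<mu>: "\<mu> j > 0" using False \<mu>0[of j] by simp
    have x: "\<mu> j \<le> x" "1 / m \<le> x" "0 < x" using \<mu> m by (auto simp: x_def intro: add_pos_pos)
    \<comment> \<open>The two signs are used in turn: \<open>\<mu> j\<close> is first raised to
      \<open>x\<close> under a nonnegative exponent, then \<open>x\<close> is lowered to
      \<open>1 / m\<close> under a nonpositive one. One factor \<open>\<mu> j\<close> is kept for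
      the sum over the cells.\<close>
    have e: "s / r - 1 \<ge> 0" "s / r - s \<le> 0" using rs by (simp_all add: field_simps)
    have "\<mu> j powr (s / r) * \<tau> j powr (1 - s) = \<mu> j * (\<mu> j powr (s / r - 1) * (x powr (1 - s) * T powr (s - 1)))"
      using \<mu> T x by (simp add: \<tau>_def x_def[symmetric] powr_divide powr_diff)
    also have "\<dots> \<le> \<mu> j * (x powr (s / r - 1) * (x powr (1 - s) * T powr (s - 1)))"
      using \<mu> x e by (intro mult_left_mono mult_right_mono powr_mono2) auto
    also have "\<dots> = \<mu> j * (x powr (s / r - s) * T powr (s - 1))"
      using powr_add[of x "s / r - 1" "1 - s"] by simp
    also have "\<dots> \<le> \<mu> j * ((1 / m) powr (s / r - s) * T powr (s - 1))"
      using \<mu> x e m by (intro mult_left_mono mult_right_mono powr_mono2') auto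
    also have "(1 / m) powr (s / r - s) = real m powr (s - s / r)"
      using m by (simp add: powr_divide powr_diff)
    finally show ?thesis .
  qed (use T in simp)
  have "measure_pmf.prob (hamming_random_instance c n d) {(P, p, q). run_query S P q = p}
    \<le> (\<Sum>j<m. \<tau> j * (real w + 1) + n * (\<mu> j powr (s / r) * \<tau> j powr (1 - s))) / n"
    unfolding single_probe_success_eq[OF n S]
    by (intro divide_right_mono sum_mono cell_success_le[OF c rs S _ \<tau> \<mu>_def small'[unfolded \<eta>_def]]) auto
  also have "\<dots> = (\<Sum>j<m. \<tau> j) * (real w + 1) / n + (\<Sum>j<m. \<mu> j powr (s / r) * \<tau> j powr (1 - s))"
    using n by (simp add: sum.distrib sum_distrib_right sum_distrib_left[symmetric] add_divide_distrib)
  also have "(\<Sum>j<m. \<tau> j) * (real w + 1) / n = 1 / 10"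
  proof -
    have "(\<Sum>j<m. \<tau> j) = 2 / T"
      using m \<mu>_sum by (simp add: \<tau>_def sum_divide_distrib[symmetric] sum.distrib)
    then show ?thesis using n by (simp add: T_def add.commute)
  qed
  also have "(\<Sum>j<m. \<mu> j powr (s / r) * \<tau> j powr (1 - s)) \<le> (\<Sum>j<m. \<mu> j * (real m powr (s - s / r) * T powr (s - 1)))"
    by (intro sum_mono large)
  also have "\<dots> = real m powr (s - s / r) * T powr (s - 1)"
    by (simp add: sum_distrib_right[symmetric] \<mu>_sum)
  finally show "measure_pmf.prob (hamming_random_instance c n d) {(P, p, q). run_query S P q = p}
    \<le> 1 / 10 + real m powr (s - s / r) * (20 * (real w + 1) / n) powr (s - 1)"
    unfolding T_def by simp
qed

section \<open>Asymptotics\<close>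

text \<open>Averaging over the coins of the structure. The integral is taken in the extended
  nonnegative reals since the support of \<open>D\<close> may be infinite.\<close>

lemma success_probability_le:
  assumes "0 \<le> \<beta>"
    and "\<And>S. S \<in> set_pmf D \<Longrightarrow>
      measure_pmf.prob (hamming_random_instance c n d) {(P, p, q). run_query S P q = p} \<le> \<beta>"
  shows "success_probability c n d D \<le> \<beta>"
proof -
  let ?I = "hamming_random_instance c n d"
  let ?A = "{(S, P, p, q). run_query S P q = p}"
  have pair: "pair_pmf D ?I = bind_pmf D (\<lambda>S. map_pmf (Pair S) ?I)"
    by (simp add: pair_pmf_def map_pmf_def)
  have "emeasure (pair_pmf D ?I) ?A = (\<integral>\<^sup>+ S. emeasure (map_pmf (Pair S) ?I) ?A \<partial>D)"
    unfolding pair by (rule emeasure_bind_pmf)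
  also have "\<dots> \<le> (\<integral>\<^sup>+ S. ennreal \<beta> \<partial>D)"
  proof (intro nn_integral_mono_AE AE_pmfI)
    fix S assume "S \<in> set_pmf D"
    then have "measure_pmf.prob ?I {(P, p, q). run_query S P q = p} \<le> \<beta>" by (rule assms(2))
    moreover have "Pair S -` ?A = {(P, p, q). run_query S P q = p}" by auto
    ultimately show "emeasure (map_pmf (Pair S) ?I) ?A \<le> ennreal \<beta>"
      by (simp add: measure_pmf.emeasure_eq_measure ennreal_leI)
  qed
  also have "\<dots> = ennreal \<beta>" by simp
  finally show ?thesis
    unfolding success_probability_def using assms(1)
    by (simp add: measure_pmf.emeasure_eq_measure)
qed

text \<open>For a fixed loss \<open>e\<close> a single \<open>s = 1 + x\<close> close to 1 can serve
  all large \<open>n\<close>.\<close>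

lemma eventually_cells_ge:
  fixes c e :: real
    and d w m :: "nat \<Rightarrow> nat"
    and \<delta> :: "nat \<Rightarrow> real"
    and D :: "nat \<Rightarrow> single_probe pmf"
  assumes c: "c > 1"
    and d: "(\<lambda>n. real (d n)) \<in> \<omega>(\<lambda>n. ln (real n))"
    and \<delta>: "\<delta> \<longlonglongrightarrow> 0"
    and w: "\<forall>\<^sub>F n in sequentially. real (w n) \<le> real n powr \<delta> n"
    and D: "\<forall>\<^sub>F n in sequentially. randomized_single_probe n (d n) (m n) (w n) (D n)"
    and success: "\<forall>\<^sub>F n in sequentially. success_probability c n (d n) (D n) \<ge> 2 / 3"
    and e: "0 < e"
  shows "\<forall>\<^sub>F n in sequentially. 0 < m n \<and> real n powr ((c / (c - 1))\<^sup>2 - e) \<le> real (m n)"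
proof -
  define a where "a = (c / (c - 1))\<^sup>2"
  define \<rho> where "\<rho> = 1 - 1 / c"
  have \<rho>: "0 < \<rho>" "\<rho> < 1" using c by (simp_all add: \<rho>_def)
  have "c / (c - 1) = 1 / \<rho>" using c by (simp add: \<rho>_def field_simps)
  then have a: "a = 1 / \<rho>\<^sup>2" by (simp add: a_def power_divide)
  then have a0: "a > 0" using \<rho> by simp
  \<comment> \<open>The exponent reached below is at least \<open>a * (1 - 3 * x)\<close>, which
    explains \<open>e / (3 * a)\<close>; the cap 1/4 keeps \<open>1 - 2 * x\<close> positive and
    \<open>s\<close> below 2.\<close>
  define x where "x = min (1 / 4) (e / (3 * a))"
  have x: "0 < x" "x \<le> 1 / 4" "3 * x * a \<le> e"
    using e a0 by (auto simp: x_def min_def field_simps)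
  define s r where "s = 1 + x" and "r = 1 + \<rho>\<^sup>2 * x"
  have \<rho>2: "0 < \<rho>\<^sup>2" "\<rho>\<^sup>2 \<le> 1" using \<rho> by (simp_all add: power_le_one)
  have rs: "1 < r" "r \<le> s" "s < 2" "(1 - 1 / c)\<^sup>2 * (s - 1) = r - 1"
    using x \<rho>2 by (auto simp: s_def r_def \<rho>_def[symmetric])
  \<comment> \<open>Chosen so that \<open>s - s / r = x * \<kappa>\<close>: an x-th root then
    removes \<open>x\<close> from both exponents of the bound. As \<open>x\<close> tends to 0,
    \<open>\<kappa>\<close> tends to \<open>\<rho>\<^sup>2\<close>, the reciprocal of
    \<open>a\<close>.\<close>
  define \<kappa> where "\<kappa> = \<rho>\<^sup>2 * (s / r)"
  have \<kappa>: "\<kappa> > 0" using \<rho>2 rs by (simp add: \<kappa>_def)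
  have s_r: "s - s / r = x * \<kappa>"
    using rs by (simp add: \<kappa>_def s_def r_def field_simps)
  have exponent: "a - e \<le> (1 - 2 * x) / \<kappa>"
  proof -
    have "1 - x \<le> 1 / s" using x by (simp add: s_def field_simps)
    also have "\<dots> \<le> r / s" using rs by (intro divide_right_mono) auto
    finally have "(1 - 2 * x) * (1 - x) \<le> (1 - 2 * x) * (r / s)"
      using x by (intro mult_left_mono) auto
    moreover have "1 - 3 * x \<le> (1 - 2 * x) * (1 - x)" by (simp add: algebra_simps)
    ultimately have "a * (1 - 3 * x) \<le> a * ((1 - 2 * x) * (r / s))"
      using a0 by (intro mult_left_mono) auto
    moreover have "(1 - 2 * x) / \<kappa> = a * ((1 - 2 * x) * (r / s))"
      by (simp add: \<kappa>_def a)
    ultimately show ?thesis using x by (simp add: algebra_simps)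
  qed
  define L where "L = - ln (1 - 1 / (2 * c))"
  have L: "L > 0" using c by (simp add: L_def)
  \<comment> \<open>The guessing factor is exp(-L d), hence eventually at most n^(-2), which
    outweighs the at most linear factor \<open>w n + 1\<close>.\<close>
  have "\<forall>\<^sub>F n in sequentially. norm (real (d n)) \<ge> 2 / L * norm (ln (real n))"
    using landau_omega.smallD[OF d, of "2 / L"] L by simp
  moreover have "\<forall>\<^sub>F n in sequentially. \<delta> n < x"
    using order_tendstoD(2)[OF \<delta> x(1)] .
  moreover have "\<forall>\<^sub>F n in sequentially. 80 * (1 / real n) \<le> ln 2"
    by real_asymp
  \<comment> \<open>The 40 bounds the constant in \<open>T\<close>, and
    \<open>2 powr (1 / x)\<close> arises from the x-th root of 1/2.\<close>
  moreover have "\<forall>\<^sub>F n in sequentially. 40 * 2 powr (1 / x) \<le> real n powr x"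
    using x(1) by real_asymp
  ultimately show ?thesis
    using w D success eventually_ge_at_top[of 2]
  proof eventually_elim
    case (elim n)
    have n: "real n \<ge> 2" using elim by simp
    have w_le: "real (w n) + 1 \<le> 2 * real n powr x"
    proof -
      have "real n powr \<delta> n \<le> real n powr x" using elim n by (intro powr_mono) auto
      moreover have "1 \<le> real n powr x" using n x by (simp add: ge_one_powr_ge_zero)
      ultimately show ?thesis using elim(5) by linarith
    qed
    have small: "exp (40 * (real (w n) + 1) * (1 - 1 / (2 * c)) ^ d n) \<le> 2"
    proof -
      have "2 * ln (real n) \<le> L * real (d n)"
        using elim(1) L n by (simp add: field_simps)
      then have "exp (- (L * real (d n))) \<le> exp (- (2 * ln (real n)))" by simp
      also have "\<dots> = 1 / (real n)\<^sup>2"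
        using n by (simp add: exp_minus exp_double power2_eq_square inverse_eq_divide)
      finally have "exp (- (L * real (d n))) \<le> 1 / (real n)\<^sup>2" .
      moreover have "(1 - 1 / (2 * c)) ^ d n = exp (- (L * real (d n)))"
        using c by (simp add: L_def exp_of_nat2_mult)
      ultimately have \<eta>: "(1 - 1 / (2 * c)) ^ d n \<le> 1 / (real n)\<^sup>2" by simp
      have "real n powr x \<le> real n powr 1" using n x by (intro powr_mono) auto
      then have w_le': "40 * (real (w n) + 1) \<le> 80 * real n" using w_le n by simp
      have "40 * (real (w n) + 1) * (1 - 1 / (2 * c)) ^ d n \<le> 80 * real n * (1 / (real n)\<^sup>2)"
        by (rule mult_mono[OF w_le' \<eta>]) (use c in auto)
      also have "\<dots> = 80 * (1 / real n)" using n by (simp add: power2_eq_square)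
      also have "\<dots> \<le> ln 2" by (rule elim)
      finally have "exp (40 * (real (w n) + 1) * (1 - 1 / (2 * c)) ^ d n) \<le> exp (ln 2)"
        by (rule exp_le_cancel_iff[THEN iffD2])
      then show ?thesis by simp
    qed
    have uses: "uses_cells n (d n) (m n) (w n) S" if "S \<in> set_pmf (D n)" for S
      using elim that by (auto simp: randomized_single_probe_def)
    have n0: "0 < n" using n by simp
    note bound = single_probe_success_le[OF c rs n0 uses small]
    obtain S where "S \<in> set_pmf (D n)" using set_pmf_not_empty[of "D n"] by blast
    then have m: "0 < m n" by (rule bound(1))
    define T where "T = 20 * (real (w n) + 1) / n"
    have T: "T > 0" using n by (simp add: T_def)
    have "2 / 3 \<le> 1 / 10 + real (m n) powr (s - s / r) * T powr (s - 1)"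
      using elim success_probability_le[OF _ bound(2), of "D n"] unfolding T_def by (smt (verit) powr_ge_zero mult_nonneg_nonneg divide_nonneg_nonneg)
    \<comment> \<open>Here 1/2 is a round value below 2/3 - 1/10.\<close>
    then have "1 / 2 \<le> real (m n) powr (x * \<kappa>) * T powr x"
      unfolding s_r by (simp add: s_def)
    also have "\<dots> = (real (m n) powr \<kappa> * T) powr x"
      by (simp add: powr_mult powr_powr mult.commute)
    finally have "(1 / 2) powr (1 / x) \<le> ((real (m n) powr \<kappa> * T) powr x) powr (1 / x)"
      using x by (intro powr_mono2) auto
    also have "\<dots> = real (m n) powr \<kappa> * T"
      using x T m by (simp add: powr_powr)
    also have "\<dots> \<le> real (m n) powr \<kappa> * (40 * real n powr x / n)"
      using w_le n by (intro mult_left_mono) (auto simp: T_def divide_right_mono)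
    finally have "1 \<le> 2 powr (1 / x) * (real (m n) powr \<kappa> * (40 * real n powr x / n))"
      by (simp add: powr_divide field_simps)
    also have "\<dots> = real (m n) powr \<kappa> * (40 * 2 powr (1 / x)) * (real n powr x / n)"
      by simp
    \<comment> \<open>A second factor n^x absorbs the constants; the first came from the cell size,
      and together they leave the exponent \<open>1 - 2 * x\<close>.\<close>
    also have "\<dots> \<le> real (m n) powr \<kappa> * real n powr x * (real n powr x / n)"
      using elim by (intro mult_right_mono mult_left_mono) auto
    also have "\<dots> = real (m n) powr \<kappa> / real n powr (1 - 2 * x)"
      using n by (simp add: powr_diff powr_add[symmetric])
    finally have "real n powr (1 - 2 * x) \<le> real (m n) powr \<kappa>"
      using n by (simp add: pos_le_divide_eq)
    then have "(real n powr (1 - 2 * x)) powr (1 / \<kappa>) \<le> (real (m n) powr \<kappa>) powr (1 / \<kappa>)"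
      using \<kappa> by (intro powr_mono2) auto
    then have "real n powr ((1 - 2 * x) / \<kappa>) \<le> real (m n)"
      using \<kappa> m by (simp add: powr_powr)
    moreover have "real n powr (a - e) \<le> real n powr ((1 - 2 * x) / \<kappa>)"
      using exponent n by (intro powr_mono) auto
    ultimately show ?case using m by (simp add: a_def)
  qed
qed

theorem theorem2:
  fixes c :: real
    and d w m :: "nat \<Rightarrow> nat"
    and \<delta> :: "nat \<Rightarrow> real"
    and D :: "nat \<Rightarrow> single_probe pmf"
  assumes "c > 1"
    and "(\<lambda>n. real (d n)) \<in> \<omega>(\<lambda>n. ln (real n))"
    and "\<delta> \<longlonglongrightarrow> 0"
    and "\<forall>\<^sub>F n in sequentially. real (w n) \<le> real n powr \<delta> n"
    and "\<forall>\<^sub>F n in sequentially. randomized_single_probe n (d n) (m n) (w n) (D n)"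
    and "\<forall>\<^sub>F n in sequentially. success_probability c n (d n) (D n) \<ge> 2 / 3"
  shows "\<exists>\<epsilon> :: nat \<Rightarrow> real. \<epsilon> \<longlonglongrightarrow> 0 \<and>
           (\<forall>\<^sub>F n in sequentially. real (m n) \<ge> real n powr ((c / (c - 1))\<^sup>2 - \<epsilon> n))"
proof -
  define a where "a = (c / (c - 1))\<^sup>2"
  have m: "\<forall>\<^sub>F n in sequentially. 0 < m n \<and> real n powr (a - e) \<le> real (m n)" if "0 < e" for e
    unfolding a_def by (rule eventually_cells_ge[OF assms that])
  \<comment> \<open>The least nonnegative loss that \<open>m n\<close> permits. Truncation at 0
    makes the lower half of the convergence trivial, so only the eventual bounds for each fixed loss
    are left to use.\<close>
  define \<epsilon> where "\<epsilon> n = max 0 (a - ln (real (m n)) / ln (real n))" for n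
  have "\<epsilon> \<longlonglongrightarrow> 0"
  proof (rule order_tendstoI)
    fix y :: real assume "0 < y"
    then have "0 < y / 2" by simp
    from m[OF this] show "\<forall>\<^sub>F n in sequentially. \<epsilon> n < y"
      using eventually_ge_at_top[of 2]
    proof eventually_elim
      case (elim n)
      then have "ln (real n powr (a - y / 2)) \<le> ln (real (m n))" by (subst ln_le_cancel_iff) auto
      then have "(a - y / 2) * ln (real n) \<le> ln (real (m n))" using elim by (simp add: ln_powr)
      then have "a - y / 2 \<le> ln (real (m n)) / ln (real n)"
        using elim by (simp add: pos_le_divide_eq)
      then show ?case using \<open>0 < y\<close> by (simp add: \<epsilon>_def)
    qed
  qed (auto simp: \<epsilon>_def less_max_iff_disj)
  \<comment> \<open>The instance with loss 1 supplies \<open>0 < m n\<close>, so that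
    \<open>m n\<close> is recovered from its logarithm.\<close>
  moreover have "\<forall>\<^sub>F n in sequentially. real n powr (a - \<epsilon> n) \<le> real (m n)"
    using m[OF zero_less_one] eventually_ge_at_top[of 2]
  proof eventually_elim
    case (elim n)
    have "real n powr (a - \<epsilon> n) \<le> real n powr (ln (real (m n)) / ln (real n))"
      using elim by (intro powr_mono) (auto simp: \<epsilon>_def)
    also have "\<dots> = real (m n)"
      using elim by (simp add: powr_def)
    finally show ?case .
  qed
  ultimately show ?thesis unfolding a_def by blast
qed

end
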